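(* Every nonempty zero-closed semigroup $X$ has a minimal ideal.
   Context: For a semigroup $X$, the $0$-extension of $X$ is the semigroup $X^0=X\cup\{0\}$, where $0\notin X$ is a new element with $0x=0=x0$ for every $x\in X^0$. A topology on a semigroup $S$ is a semigroup topology if the binary operation $S\times S\to S$ is continuous. A semigroup $X$ (carrying no topology) is zero-closed if $X$ is a closed subset of $X^0$ for every Hausdorff semigroup topology on $X^0$. A subset $I$ of a semigroup $X$ is an ideal if $IX\cup XI\subseteq I$. An ideal $I$ in $X$ is called minimal if $I\neq\emptyset$ and $I\subseteq J$ for every nonempty ideal $J$ in $X$. *)

theory Defs
  imports "HOL-Analysis.Analysis"
begin

(* A semigroup is a carrier set together with a multiplication that is only required to
   behave on the carrier, so that the empty semigroup is covered as well. *)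
definition semigroup_on :: "'a set \<Rightarrow> ('a \<Rightarrow> 'a \<Rightarrow> 'a) \<Rightarrow> bool" where
  "semigroup_on X m \<longleftrightarrow>
     (\<forall>x\<in>X. \<forall>y\<in>X. m x y \<in> X) \<and>
     (\<forall>x\<in>X. \<forall>y\<in>X. \<forall>z\<in>X. m (m x y) z = m x (m y z))"

(* The 0-extension: None is the new element 0, and X is identified with Some ` X. *)
definition zero_ext :: "'a set \<Rightarrow> 'a option set" where
  "zero_ext X = insert None (Some ` X)"

fun zero_ext_mult :: "('a \<Rightarrow> 'a \<Rightarrow> 'a) \<Rightarrow> 'a option \<Rightarrow> 'a option \<Rightarrow> 'a option" where
  "zero_ext_mult m (Some x) (Some y) = Some (m x y)"
| "zero_ext_mult m None y = None"
| "zero_ext_mult m (Some x) None = None"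

lemma zero_ext_mult_None_right [simp]: "zero_ext_mult m x None = None"
  by (cases x) auto

lemma semigroup_on_zero_ext:
  assumes "semigroup_on X m"
  shows "semigroup_on (zero_ext X) (zero_ext_mult m)"
  using assms by (auto simp: semigroup_on_def zero_ext_def)

definition semigroup_topology :: "'a set \<Rightarrow> ('a \<Rightarrow> 'a \<Rightarrow> 'a) \<Rightarrow> 'a topology \<Rightarrow> bool" where
  "semigroup_topology S m T \<longleftrightarrow>
     topspace T = S \<and> continuous_map (prod_topology T T) T (\<lambda>(x, y). m x y)"

definition zero_closed :: "'a set \<Rightarrow> ('a \<Rightarrow> 'a \<Rightarrow> 'a) \<Rightarrow> bool" where
  "zero_closed X m \<longleftrightarrow>
     (\<forall>T. semigroup_topology (zero_ext X) (zero_ext_mult m) T \<and> Hausdorff_space T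
          \<longrightarrow> closedin T (Some ` X))"

(* Two-sided ideals; the empty set is allowed. *)
definition semigroup_ideal :: "'a set \<Rightarrow> ('a \<Rightarrow> 'a \<Rightarrow> 'a) \<Rightarrow> 'a set \<Rightarrow> bool" where
  "semigroup_ideal X m I \<longleftrightarrow>
     I \<subseteq> X \<and> {m i x | i x. i \<in> I \<and> x \<in> X} \<union> {m x i | x i. x \<in> X \<and> i \<in> I} \<subseteq> I"

(* Minimal in the sense of least: contained in every nonempty ideal. *)
definition minimal_ideal :: "'a set \<Rightarrow> ('a \<Rightarrow> 'a \<Rightarrow> 'a) \<Rightarrow> 'a set \<Rightarrow> bool" where
  "minimal_ideal X m I \<longleftrightarrow>
     semigroup_ideal X m I \<and> I \<noteq> {} \<and>
     (\<forall>J. semigroup_ideal X m J \<and> J \<noteq> {} \<longrightarrow> I \<subseteq> J)"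

end

theory Submission
  imports Defs
begin

text \<open>
  A nonempty semigroup \<open>X\<close> without a minimal ideal carries a Hausdorff semigroup topology on \<open>X\<^sup>0\<close>
  in which \<open>X\<close> is not closed: let every point of \<open>X\<close> be isolated and let the sets \<open>I \<union> {0}\<close>, with
  \<open>I\<close> a nonempty ideal of \<open>X\<close>, form a neighbourhood base at \<open>0\<close>.

  Since \<open>I J \<subseteq> I \<inter> J\<close>, any two nonempty ideals meet, so this is a topology, and \<open>0\<close> is not isolated
  in it. The absorption law of an ideal is continuity of the multiplication at the pairs
  \<open>(x, 0)\<close> and \<open>(0, x)\<close>; pairs of points of \<open>X\<close> are isolated. Finally, a point \<open>x\<close> cannot be
  separated from \<open>0\<close> only if \<open>x\<close> lies in every nonempty ideal; but then the intersection of all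
  nonempty ideals is a nonempty ideal and hence the minimal one.
\<close>

lemma semigroup_ideal_iff:
  "semigroup_ideal X m I \<longleftrightarrow> I \<subseteq> X \<and> (\<forall>i\<in>I. \<forall>x\<in>X. m i x \<in> I \<and> m x i \<in> I)"
  unfolding semigroup_ideal_def by blast

lemma semigroup_ideal_Int:
  assumes "semigroup_ideal X m I" "semigroup_ideal X m J"
  shows "semigroup_ideal X m (I \<inter> J)"
  using assms by (auto simp: semigroup_ideal_iff)

text \<open>A product \<open>i j\<close> with \<open>i \<in> I\<close> and \<open>j \<in> J\<close> lies in both ideals.\<close>

lemma semigroup_ideal_Int_nonempty:
  assumes "semigroup_ideal X m I" "I \<noteq> {}" "semigroup_ideal X m J" "J \<noteq> {}"
  shows "I \<inter> J \<noteq> {}"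
proof -
  obtain i j where "i \<in> I" "j \<in> J"
    using assms by blast
  with assms have "m i j \<in> I \<inter> J"
    by (auto simp: semigroup_ideal_iff)
  then show ?thesis by blast
qed

lemma semigroup_ideal_carrier:
  assumes "semigroup_on X m"
  shows "semigroup_ideal X m X"
  using assms by (auto simp: semigroup_ideal_iff semigroup_on_def)

lemma minimal_ideal_if_common_point:
  assumes "semigroup_on X m" and "x \<in> X"
    and "\<And>I. semigroup_ideal X m I \<Longrightarrow> I \<noteq> {} \<Longrightarrow> x \<in> I"
  shows "minimal_ideal X m (\<Inter>{I. semigroup_ideal X m I \<and> I \<noteq> {}})"
proof -
  let ?\<I> = "{I. semigroup_ideal X m I \<and> I \<noteq> {}}"
  \<comment> \<open>The carrier is a member, which keeps the intersection inside \<open>X\<close>.\<close>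
  have "X \<in> ?\<I>"
    using assms semigroup_ideal_carrier by blast
  moreover have "m i y \<in> I \<and> m y i \<in> I" if "i \<in> \<Inter>?\<I>" "y \<in> X" "I \<in> ?\<I>" for i y I
  proof -
    have "i \<in> I" using that by blast
    then show ?thesis
      using that(2,3) by (auto simp: semigroup_ideal_iff)
  qed
  ultimately have "semigroup_ideal X m (\<Inter>?\<I>)"
    unfolding semigroup_ideal_iff by blast
  moreover have "x \<in> \<Inter>?\<I>"
    using assms(3) by blast
  ultimately show ?thesis
    unfolding minimal_ideal_def by blast
qed

definition ideal_topology :: "'a set \<Rightarrow> ('a \<Rightarrow> 'a \<Rightarrow> 'a) \<Rightarrow> 'a option topology" where
  "ideal_topology X m = topology (\<lambda>U. U \<subseteq> zero_ext X \<and>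
     (None \<in> U \<longrightarrow> (\<exists>I. semigroup_ideal X m I \<and> I \<noteq> {} \<and> Some ` I \<subseteq> U)))"

lemma openin_ideal_topology:
  "openin (ideal_topology X m) U \<longleftrightarrow> U \<subseteq> zero_ext X \<and>
     (None \<in> U \<longrightarrow> (\<exists>I. semigroup_ideal X m I \<and> I \<noteq> {} \<and> Some ` I \<subseteq> U))"
proof -
  let ?P = "\<lambda>U. U \<subseteq> zero_ext X \<and>
     (None \<in> U \<longrightarrow> (\<exists>I. semigroup_ideal X m I \<and> I \<noteq> {} \<and> Some ` I \<subseteq> U))"
  have "?P (S \<inter> T)" if S: "?P S" and T: "?P T" for S T
  proof (intro conjI impI)
    show "S \<inter> T \<subseteq> zero_ext X" using S by blast
    assume "None \<in> S \<inter> T"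
    then obtain I J
      where I: "semigroup_ideal X m I" "I \<noteq> {}" "Some ` I \<subseteq> S"
        and J: "semigroup_ideal X m J" "J \<noteq> {}" "Some ` J \<subseteq> T"
      using S T by blast
    show "\<exists>K. semigroup_ideal X m K \<and> K \<noteq> {} \<and> Some ` K \<subseteq> S \<inter> T"
    proof (intro exI conjI)
      show "semigroup_ideal X m (I \<inter> J)"
        using I(1) J(1) by (rule semigroup_ideal_Int)
      show "I \<inter> J \<noteq> {}"
        using I(1,2) J(1,2) by (rule semigroup_ideal_Int_nonempty)
      show "Some ` (I \<inter> J) \<subseteq> S \<inter> T"
        using I(3) J(3) by blast
    qed
  qed
  moreover have "?P (\<Union>\<K>)" if \<K>: "\<forall>S\<in>\<K>. ?P S" for \<K>
  proof (intro conjI impI)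
    show "\<Union>\<K> \<subseteq> zero_ext X" using \<K> by blast
    assume "None \<in> \<Union>\<K>"
    then obtain S where "S \<in> \<K>" "None \<in> S" by blast
    then show "\<exists>I. semigroup_ideal X m I \<and> I \<noteq> {} \<and> Some ` I \<subseteq> \<Union>\<K>"
      using \<K> by (meson Union_upper subset_trans)
  qed
  ultimately have "istopology ?P"
    unfolding istopology_def by blast
  then show ?thesis
    by (simp add: ideal_topology_def topology_inverse')
qed

lemma topspace_ideal_topology:
  assumes "semigroup_on X m" and "X \<noteq> {}"
  shows "topspace (ideal_topology X m) = zero_ext X"
proof -
  have "openin (ideal_topology X m) (zero_ext X)"
    using assms semigroup_ideal_carrier
    by (auto simp: openin_ideal_topology zero_ext_def)
  then show ?thesis
    by (metis openin_ideal_topology openin_subset openin_topspace subset_antisym)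
qed

lemma openin_ideal_topology_singleton:
  "x \<in> X \<Longrightarrow> openin (ideal_topology X m) {Some x}"
  by (auto simp: openin_ideal_topology zero_ext_def)

lemma openin_ideal_topology_insert_None:
  assumes "semigroup_ideal X m I" and "I \<noteq> {}"
  shows "openin (ideal_topology X m) (insert None (Some ` I))"
  using assms by (auto simp: openin_ideal_topology zero_ext_def semigroup_ideal_def)

text \<open>
  The neighbourhood \<open>V\<close> of \<open>0\<close> given by an ideal absorbs all of \<open>X\<^sup>0\<close>, so \<open>V \<times> X\<^sup>0\<close> and
  \<open>X\<^sup>0 \<times> V\<close> witness continuity at every pair with an entry \<open>0\<close>.
\<close>

lemma semigroup_topology_ideal_topology:
  assumes "semigroup_on X m" and "X \<noteq> {}"
  shows "semigroup_topology (zero_ext X) (zero_ext_mult m) (ideal_topology X m)"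
proof -
  let ?T = "ideal_topology X m" and ?S = "zero_ext X"
  have top: "topspace ?T = ?S"
    using assms by (rule topspace_ideal_topology)
  then have openS: "openin ?T ?S"
    by (metis openin_topspace)
  have closed: "zero_ext_mult m a b \<in> ?S" if "a \<in> ?S" "b \<in> ?S" for a b
    using semigroup_on_zero_ext[OF assms(1)] that by (auto simp: semigroup_on_def)
  have nbhd: "\<exists>V W. openin ?T V \<and> openin ?T W \<and> a \<in> V \<and> b \<in> W \<and>
      (\<forall>v\<in>V. \<forall>w\<in>W. zero_ext_mult m v w \<in> U)"
    if ab: "a \<in> ?S" "b \<in> ?S" and U: "openin ?T U" "zero_ext_mult m a b \<in> U" for a b U
  proof (cases "a = None \<or> b = None")
    case False
    then obtain x y where "a = Some x" "b = Some y" "x \<in> X" "y \<in> X"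
      using ab by (auto simp: zero_ext_def)
    with U show ?thesis
      by (intro exI[of _ "{a}"] exI[of _ "{b}"]) (simp add: openin_ideal_topology_singleton)
  next
    case True
    then have "None \<in> U"
      using U(2) by auto
    then obtain I where I: "semigroup_ideal X m I" "I \<noteq> {}" "Some ` I \<subseteq> U"
      using U(1) unfolding openin_ideal_topology by blast
    let ?V = "insert None (Some ` I)"
    have V: "openin ?T ?V" "?V \<subseteq> U"
      using openin_ideal_topology_insert_None[OF I(1,2)] I(3) \<open>None \<in> U\<close> by auto
    have "zero_ext_mult m v s \<in> ?V \<and> zero_ext_mult m s v \<in> ?V" if "v \<in> ?V" "s \<in> ?S" for v s
      using that I(1) by (auto simp: zero_ext_def semigroup_ideal_iff)
    then have absorb: "\<forall>v\<in>?V. \<forall>s\<in>?S. zero_ext_mult m v s \<in> U \<and> zero_ext_mult m s v \<in> U"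
      using V(2) by blast
    show ?thesis
    proof (cases "a = None")
      case True
      then show ?thesis
        using V(1) openS absorb ab by (intro exI[of _ ?V] exI[of _ ?S]) simp
    next
      case False
      then have "b = None" using True by blast
      then show ?thesis
        using V(1) openS absorb ab by (intro exI[of _ ?S] exI[of _ ?V]) simp
    qed
  qed
  have "openin (prod_topology ?T ?T)
      {z \<in> ?S \<times> ?S. (case z of (a, b) \<Rightarrow> zero_ext_mult m a b) \<in> U}" (is "openin _ ?pre")
    if U: "openin ?T U" for U
    unfolding openin_prod_topology_alt
  proof (intro allI impI)
    fix a b assume "(a, b) \<in> ?pre"
    then obtain V W where VW: "openin ?T V" "openin ?T W" "a \<in> V" "b \<in> W"
        "\<forall>v\<in>V. \<forall>w\<in>W. zero_ext_mult m v w \<in> U"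
      using nbhd[of a b U] U by auto
    moreover have "V \<subseteq> ?S" "W \<subseteq> ?S"
      using VW(1,2) openin_subset top by blast+
    ultimately have "V \<times> W \<subseteq> ?pre" by auto
    with VW show "\<exists>V W. openin ?T V \<and> openin ?T W \<and> a \<in> V \<and> b \<in> W \<and> V \<times> W \<subseteq> ?pre"
      by blast
  qed
  then have "continuous_map (prod_topology ?T ?T) ?T (\<lambda>(a, b). zero_ext_mult m a b)"
    using closed by (auto simp: continuous_map_def top)
  with top show ?thesis
    by (simp add: semigroup_topology_def)
qed

lemma Hausdorff_space_ideal_topology:
  assumes X: "semigroup_on X m" "X \<noteq> {}"
    and avoid: "\<And>x. x \<in> X \<Longrightarrow> \<exists>I. semigroup_ideal X m I \<and> I \<noteq> {} \<and> x \<notin> I"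
  shows "Hausdorff_space (ideal_topology X m)"
proof -
  let ?T = "ideal_topology X m"
  have sep0: "\<exists>V W. openin ?T V \<and> openin ?T W \<and> Some x \<in> V \<and> None \<in> W \<and> disjnt V W"
    if "x \<in> X" for x
  proof -
    obtain I where "semigroup_ideal X m I" "I \<noteq> {}" "x \<notin> I"
      using avoid \<open>x \<in> X\<close> by blast
    then show ?thesis
      using openin_ideal_topology_singleton[OF \<open>x \<in> X\<close>, of m]
        openin_ideal_topology_insert_None[of X m I]
      by (intro exI[of _ "{Some x}"] exI[of _ "insert None (Some ` I)"]) (auto simp: disjnt_def)
  qed
  show ?thesis
    unfolding Hausdorff_space_def topspace_ideal_topology[OF X]
  proof (intro allI impI)
    fix a b assume ab: "a \<in> zero_ext X \<and> b \<in> zero_ext X \<and> a \<noteq> b"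
    then consider x y where "a = Some x" "b = Some y" "x \<in> X" "y \<in> X" "x \<noteq> y"
      | x where "a = Some x" "b = None" "x \<in> X"
      | y where "a = None" "b = Some y" "y \<in> X"
      by (auto simp: zero_ext_def)
    then show "\<exists>V W. openin ?T V \<and> openin ?T W \<and> a \<in> V \<and> b \<in> W \<and> disjnt V W"
    proof cases
      case 1
      then show ?thesis
        by (intro exI[of _ "{a}"] exI[of _ "{b}"])
          (simp add: openin_ideal_topology_singleton disjnt_def)
    next
      case 2
      then show ?thesis using sep0 by blast
    next
      case 3
      then show ?thesis using sep0 disjnt_sym by metis
    qed
  qed
qed

lemma not_closedin_ideal_topology:
  assumes "semigroup_on X m" and "X \<noteq> {}"
  shows "\<not> closedin (ideal_topology X m) (Some ` X)"
proof
  assume "closedin (ideal_topology X m) (Some ` X)"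
  then have "openin (ideal_topology X m) (zero_ext X - Some ` X)"
    by (simp add: closedin_def topspace_ideal_topology[OF assms])
  also have "zero_ext X - Some ` X = {None}"
    by (auto simp: zero_ext_def)
  finally show False
    by (auto simp: openin_ideal_topology)
qed

theorem proposition1:
  fixes X :: "'a set" and m :: "'a \<Rightarrow> 'a \<Rightarrow> 'a"
  assumes "semigroup_on X m"
    and "X \<noteq> {}"
    and "zero_closed X m"
  shows "\<exists>I. minimal_ideal X m I"
proof (rule ccontr)
  assume "\<nexists>I. minimal_ideal X m I"
  then have "\<exists>I. semigroup_ideal X m I \<and> I \<noteq> {} \<and> x \<notin> I" if "x \<in> X" for x
    using minimal_ideal_if_common_point[OF assms(1) that] by blast
  then have "Hausdorff_space (ideal_topology X m)"
    using Hausdorff_space_ideal_topology[OF assms(1,2)] by blast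
  then have "closedin (ideal_topology X m) (Some ` X)"
    using assms(3) semigroup_topology_ideal_topology[OF assms(1,2)]
    unfolding zero_closed_def by blast
  then show False
    using not_closedin_ideal_topology[OF assms(1,2)] by blast
qed

end
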